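(* There is a constant $C>0$ depending only on $c_0$ such that the following holds. Let $D\ge1$ and $\delta\in(0,1)$, and set $\epsilon_0=\max\!\left(1,\sqrt{\log(D/\delta)/c_0}\right)$. Run \texttt{ADSampling} with parameter $\epsilon_0$ and the schedule $d_j=j$ ($j=1,\dots,D$). Then (i) for every $\mathbf{o},\mathbf{q}\in\mathbb{R}^D$ and $r>0$ with $\|\mathbf{o}-\mathbf{q}\|\le r$, the probability that \texttt{ADSampling} fails is at most $\delta$; and (ii) for every $\mathbf{o},\mathbf{q}\in\mathbb{R}^D$ and $r>0$ with $dis=\|\mathbf{o}-\mathbf{q}\|>r$, letting $\alpha=(dis-r)/r$, $$\mathbb{E}[\hat D]\le C\cdot\min\!\left(D,\ \max\!\left(1,\ \frac{1}{\alpha^2}\log\frac{D}{\delta}\right)\right).$$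
   Context: A random orthogonal matrix is a $D\times D$ matrix $P'$ drawn from the Haar (uniform) probability measure on the orthogonal group $O(D)$. Let $c_0>0$ be an absolute constant such that for every $D\ge1$, every $1\le d\le D$, every $\mathbf{x}\in\mathbb{R}^D$ and every $\epsilon>0$, if $P$ denotes the $d\times D$ matrix formed by the first $d$ rows of a Haar random orthogonal $D\times D$ matrix, then $\mathbb{P}\{\sqrt{D/d}\,\|P\mathbf{x}\|>(1+\epsilon)\|\mathbf{x}\|\}\le e^{-c_0 d\epsilon^2}$ and $\mathbb{P}\{\sqrt{D/d}\,\|P\mathbf{x}\|<(1-\epsilon)\|\mathbf{x}\|\}\le e^{-c_0 d\epsilon^2}$. DCO: given $\mathbf{o},\mathbf{q}\in\mathbb{R}^D$ and threshold $r>0$, with $dis=\|\mathbf{o}-\mathbf{q}\|$, the correct answer is “yes, and the distance $dis$” if $dis\le r$ and “no” if $dis>r$. \texttt{ADSampling} with parameter $\epsilon_0>0$ and schedule $d_j=j$: draw a Haar random orthogonal $P'$ and let $\mathbf{y}=P'(\mathbf{o}-\mathbf{q})$. For $d=1,\dots,D$, compute $dis'_d=\sqrt{D/d}\,\big(\sum_{i=1}^d y_i^2\big)^{1/2}$. If $d<D$ and $dis'_d>(1+\epsilon_0/\sqrt d)\,r$, stop and output “no”. If $d=D$, output “yes, and the distance $dis'_D$” if $dis'_D\le r$ and “no” otherwise. $\hat D$ is the value of $d$ at stopping; \texttt{ADSampling} fails if its output differs from the correct answer. *)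

theory Defs
  imports "HOL-Probability.Probability" "Jordan_Normal_Form.Matrix"
begin

text \<open>
  The dimension is quantified inside the theorem, so vectors and matrices are the
  dimension-carrying types of \<^theory>\<open>Jordan_Normal_Form.Matrix\<close>. Indices start at 0:
  the coordinates \<open>y\<^sub>1, \<dots>, y\<^sub>d\<close> are the entries of \<open>y\<close> with index \<open>i < d\<close>.
\<close>

definition vec_l2 :: "real vec \<Rightarrow> real" where
  "vec_l2 v = sqrt (\<Sum>i<dim_vec v. (vec_index v i)\<^sup>2)"

text \<open>
  Not the library's \<^const>\<open>orthogonal_mat\<close>, which only asks that \<open>A\<^sup>T A\<close> be diagonal
  with nonzero diagonal entries.
\<close>

definition orthogonal_group :: "nat \<Rightarrow> real mat set" where
  "orthogonal_group D = {A \<in> carrier_mat D D. transpose_mat A * A = 1\<^sub>m D}"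

text \<open>
  The Borel sets of the orthogonal group as a subspace of \<open>\<real>\<^bsup>D\<times>D\<^esup>\<close>: the trace of the product
  Borel algebra, pulled back along the map sending a matrix to its family of entries.
\<close>

definition borel_orthogonal :: "nat \<Rightarrow> real mat measure" where
  "borel_orthogonal D =
     vimage_algebra (orthogonal_group D)
       (\<lambda>A. \<lambda>ij\<in>{..<D} \<times> {..<D}. A $$ ij)
       (Pi\<^sub>M ({..<D} \<times> {..<D}) (\<lambda>_. borel))"

text \<open>
  The Haar probability measure is given by its defining property, left invariance; on a compact
  group this determines it uniquely (and implies right invariance).
\<close>

definition haar_orthogonal :: "nat \<Rightarrow> real mat measure \<Rightarrow> bool" where
  "haar_orthogonal D M \<longleftrightarrow>
     prob_space M \<and> sets M = sets (borel_orthogonal D) \<and>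
     (\<forall>Q \<in> orthogonal_group D. \<forall>A \<in> sets M. emeasure M ((\<lambda>P. Q * P) ` A) = emeasure M A)"

definition first_rows :: "nat \<Rightarrow> 'a mat \<Rightarrow> 'a mat" where
  "first_rows d A = mat d (dim_col A) (\<lambda>ij. A $$ ij)"

definition projection_concentration :: "real \<Rightarrow> bool" where
  "projection_concentration c \<longleftrightarrow>
     (\<forall>D d x \<epsilon> M. 1 \<le> d \<longrightarrow> d \<le> D \<longrightarrow> x \<in> carrier_vec D \<longrightarrow> 0 < \<epsilon> \<longrightarrow> haar_orthogonal D M \<longrightarrow>
        measure M {P' \<in> space M.
            sqrt (real D / real d) * vec_l2 (first_rows d P' *\<^sub>v x) > (1 + \<epsilon>) * vec_l2 x}
          \<le> exp (- c * real d * \<epsilon>\<^sup>2) \<and>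
        measure M {P' \<in> space M.
            sqrt (real D / real d) * vec_l2 (first_rows d P' *\<^sub>v x) < (1 - \<epsilon>) * vec_l2 x}
          \<le> exp (- c * real d * \<epsilon>\<^sup>2))"

datatype dco_answer = Yes real | No

definition dco :: "real vec \<Rightarrow> real vec \<Rightarrow> real \<Rightarrow> dco_answer" where
  "dco ob q r = (if vec_l2 (ob - q) \<le> r then Yes (vec_l2 (ob - q)) else No)"

definition approx_dis :: "nat \<Rightarrow> real vec \<Rightarrow> nat \<Rightarrow> real" where
  "approx_dis D y d = sqrt (real D / real d) * sqrt (\<Sum>i<d. (vec_index y i)\<^sup>2)"

text \<open>
  The loop from step \<open>d\<close> onwards; the result is the output together with the value of \<open>d\<close> at
  stopping.
\<close>

function ads_loop :: "nat \<Rightarrow> real \<Rightarrow> real \<Rightarrow> real vec \<Rightarrow> nat \<Rightarrow> dco_answer \<times> nat" where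
  "ads_loop D \<epsilon> r y d =
     (if d < D then
        (if approx_dis D y d > (1 + \<epsilon> / sqrt (real d)) * r then (No, d)
         else ads_loop D \<epsilon> r y (Suc d))
      else
        (if approx_dis D y d \<le> r then Yes (approx_dis D y d) else No, d))"
  by pat_completeness auto
termination
  by (relation "Wellfounded.measure (\<lambda>(D, \<epsilon>, r, y, d). D - d)") auto

declare ads_loop.simps [simp del]

definition ad_sampling ::
  "nat \<Rightarrow> real \<Rightarrow> real vec \<Rightarrow> real vec \<Rightarrow> real \<Rightarrow> real mat \<Rightarrow> dco_answer \<times> nat" where
  "ad_sampling D \<epsilon> ob q r P' = ads_loop D \<epsilon> r (P' *\<^sub>v (ob - q)) 1"

definition ads_fails :: "nat \<Rightarrow> real \<Rightarrow> real vec \<Rightarrow> real vec \<Rightarrow> real \<Rightarrow> real mat \<Rightarrow> bool" where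
  "ads_fails D \<epsilon> ob q r P' \<longleftrightarrow> fst (ad_sampling D \<epsilon> ob q r P') \<noteq> dco ob q r"

definition ads_stop :: "nat \<Rightarrow> real \<Rightarrow> real vec \<Rightarrow> real vec \<Rightarrow> real \<Rightarrow> real mat \<Rightarrow> nat" where
  "ads_stop D \<epsilon> ob q r P' = snd (ad_sampling D \<epsilon> ob q r P')"

end

theory Submission
  imports Defs
begin

text \<open>
  Orthogonality gives \<open>dis'\<^sub>D = dis\<close>, so for \<open>dis \<le> r\<close> the algorithm can only fail by exceeding a
  threshold at some \<open>d < D\<close>; each such event has probability at most \<open>exp (- c\<^sub>0 \<epsilon>\<^sub>0\<^sup>2) \<le> \<delta> / D\<close>.
  For \<open>dis > r\<close>, the stopping time is at most one plus the number of steps \<open>d < D\<close> with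
  \<open>dis'\<^sub>d \<le> (1 + \<epsilon>\<^sub>0 / sqrt d) r\<close>. At most \<open>4 \<epsilon>\<^sub>0\<^sup>2 / \<alpha>\<^sup>2\<close> steps have \<open>\<epsilon>\<^sub>0 / sqrt d > \<alpha> / 2\<close>; for the
  others the event forces \<open>dis'\<^sub>d < (1 - \<epsilon>) dis\<close> with \<open>\<epsilon> = \<alpha> / (4 (1 + \<alpha>))\<close>, and these
  probabilities are dominated by a geometric series. The case \<open>D = 1\<close> is separate because
  \<open>ln (D / \<delta>)\<close> is bounded below by a constant only for \<open>D \<ge> 2\<close>.
\<close>

section \<open>Measurability with respect to the Haar measure\<close>

lemma space_haar_orthogonal:
  assumes "haar_orthogonal D M"
  shows "space M = orthogonal_group D"
  using assms sets_eq_imp_space_eq[of M "borel_orthogonal D"]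
  by (auto simp: haar_orthogonal_def borel_orthogonal_def)

text \<open>The sigma-algebra is pulled back along the map to the family of entries, which is
  therefore measurable; a single entry is one coordinate of that family.\<close>

lemma measurable_entry_haar:
  assumes "haar_orthogonal D M" "i < D" "j < D"
  shows "(\<lambda>P. P $$ (i, j)) \<in> borel_measurable M"
proof -
  let ?I = "{..<D} \<times> {..<D}"
  let ?f = "\<lambda>A::real mat. \<lambda>ij\<in>?I. A $$ ij"
  have "?f \<in> measurable (borel_orthogonal D) (Pi\<^sub>M ?I (\<lambda>_. borel))"
    unfolding borel_orthogonal_def
    by (rule measurable_vimage_algebra1) (auto simp: space_PiM)
  hence "(\<lambda>A. ?f A (i, j)) \<in> borel_measurable (borel_orthogonal D)"
    by (rule measurable_compose) (use assms in \<open>auto intro: measurable_component_singleton\<close>)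
  moreover have "sets M = sets (borel_orthogonal D)"
    using assms by (simp add: haar_orthogonal_def)
  ultimately show ?thesis
    using assms by (simp cong: measurable_cong_sets)
qed

text \<open>On orthogonal matrices the partial distance is built from finitely many entries by sums,
  products and a square root. Monotonicity and subadditivity of the measure are applied below to
  events defined by it.\<close>

lemma measurable_approx_dis_haar:
  assumes M: "haar_orthogonal D M" and x: "x \<in> carrier_vec D" and d: "d \<le> D"
  shows "(\<lambda>P. approx_dis D (P *\<^sub>v x) d) \<in> borel_measurable M"
proof -
  have [measurable]: "(\<lambda>P. (\<Sum>i<d. (\<Sum>j<D. P $$ (i, j) * vec_index x j)\<^sup>2)) \<in> borel_measurable M"
    using d by (intro borel_measurable_sum borel_measurable_power borel_measurable_times
        measurable_entry_haar[OF M] borel_measurable_const) auto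
  have "(\<lambda>P. sqrt (real D / real d) *
          sqrt (\<Sum>i<d. (\<Sum>j<D. P $$ (i, j) * vec_index x j)\<^sup>2)) \<in> borel_measurable M"
    by measurable
  also have "?this \<longleftrightarrow> ?thesis"
  proof (rule measurable_cong)
    fix P assume "P \<in> space M"
    hence P: "P \<in> carrier_mat D D"
      using space_haar_orthogonal[OF M] by (simp add: orthogonal_group_def)
    have "vec_index (P *\<^sub>v x) i = (\<Sum>j<D. P $$ (i, j) * vec_index x j)" if "i < d" for i
      using that d P x by (auto simp: scalar_prod_def atLeast0LessThan intro!: sum.cong)
    thus "sqrt (real D / real d) * sqrt (\<Sum>i<d. (\<Sum>j<D. P $$ (i, j) * vec_index x j)\<^sup>2) =
        approx_dis D (P *\<^sub>v x) d"
      by (simp add: approx_dis_def)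
  qed
  finally show ?thesis .
qed

section \<open>Partial distances and concentration\<close>

lemma approx_dis_first_rows:
  assumes "P \<in> carrier_mat D D" "d \<le> D"
  shows "sqrt (real D / real d) * vec_l2 (first_rows d P *\<^sub>v x) = approx_dis D (P *\<^sub>v x) d"
proof -
  have "vec_index (first_rows d P *\<^sub>v x) i = vec_index (P *\<^sub>v x) i" if "i < d" for i
  proof -
    have "row (first_rows d P) i = row P i"
      using that assms by (intro eq_vecI) (auto simp: first_rows_def)
    thus ?thesis
      using that assms by (simp add: first_rows_def)
  qed
  moreover have "dim_vec (first_rows d P *\<^sub>v x) = d"
    by (simp add: first_rows_def)
  ultimately show ?thesis
    by (simp add: vec_l2_def approx_dis_def)
qed

lemma vec_l2_eq_scalar_prod: "vec_l2 v = sqrt (v \<bullet> v)"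
  by (simp add: vec_l2_def scalar_prod_def atLeast0LessThan power2_eq_square)

text \<open>Moving one factor \<open>P\<close> across the scalar product turns it into its
  transpose, which cancels the other.\<close>

lemma vec_l2_orthogonal_mult:
  assumes "P \<in> orthogonal_group D" "x \<in> carrier_vec D"
  shows "vec_l2 (P *\<^sub>v x) = vec_l2 x"
proof -
  have P: "P \<in> carrier_mat D D" and PP: "transpose_mat P * P = 1\<^sub>m D"
    using assms by (auto simp: orthogonal_group_def)
  have Px: "P *\<^sub>v x \<in> carrier_vec D"
    using P assms(2) by simp
  have "(P *\<^sub>v x) \<bullet> (P *\<^sub>v x) = (transpose_mat P *\<^sub>v (P *\<^sub>v x)) \<bullet> x"
    using transpose_vec_mult_scalar[OF P assms(2) Px] by simp
  also have "transpose_mat P *\<^sub>v (P *\<^sub>v x) = x"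
    using P PP assms(2)
    by (metis assoc_mult_mat_vec one_mult_mat_vec transpose_carrier_mat)
  finally show ?thesis
    by (simp add: vec_l2_eq_scalar_prod)
qed

text \<open>At \<open>d = D\<close> the scaling factor is 1, so the last step of the algorithm works
  with the exact distance.\<close>

lemma approx_dis_full:
  assumes "P \<in> orthogonal_group D" "x \<in> carrier_vec D" "1 \<le> D"
  shows "approx_dis D (P *\<^sub>v x) D = vec_l2 x"
proof -
  have "dim_vec (P *\<^sub>v x) = D"
    using assms by (auto simp: orthogonal_group_def)
  hence "approx_dis D (P *\<^sub>v x) D = vec_l2 (P *\<^sub>v x)"
    using assms by (simp add: approx_dis_def vec_l2_def)
  thus ?thesis
    using vec_l2_orthogonal_mult assms by simp
qed

text \<open>Carries the hypothesis over from the submatrix of the first rows to the partial sums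
  that the loop inspects.\<close>

lemma approx_dis_concentration:
  assumes c: "projection_concentration c" and M: "haar_orthogonal D M"
    and x: "x \<in> carrier_vec D" and d: "1 \<le> d" "d \<le> D" and e: "0 < \<epsilon>"
  shows "measure M {P \<in> space M. approx_dis D (P *\<^sub>v x) d > (1 + \<epsilon>) * vec_l2 x}
           \<le> exp (- c * real d * \<epsilon>\<^sup>2)"
    and "measure M {P \<in> space M. approx_dis D (P *\<^sub>v x) d < (1 - \<epsilon>) * vec_l2 x}
           \<le> exp (- c * real d * \<epsilon>\<^sup>2)"
proof -
  have eq: "sqrt (real D / real d) * vec_l2 (first_rows d P *\<^sub>v x) = approx_dis D (P *\<^sub>v x) d"
    if "P \<in> space M" for P
    using that d space_haar_orthogonal[OF M]
    by (intro approx_dis_first_rows) (auto simp: orthogonal_group_def)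
  note conc = c[unfolded projection_concentration_def, rule_format, OF d x e M]
  show "measure M {P \<in> space M. approx_dis D (P *\<^sub>v x) d > (1 + \<epsilon>) * vec_l2 x}
           \<le> exp (- c * real d * \<epsilon>\<^sup>2)"
    using conc[THEN conjunct1] by (simp add: eq cong: conj_cong)
  show "measure M {P \<in> space M. approx_dis D (P *\<^sub>v x) d < (1 - \<epsilon>) * vec_l2 x}
           \<le> exp (- c * real d * \<epsilon>\<^sup>2)"
    using conc[THEN conjunct2] by (simp add: eq cong: conj_cong)
qed

section \<open>Deterministic behaviour of the loop\<close>

lemma ads_loop_no_rejection:
  assumes "d \<le> D"
    and "\<And>e. d \<le> e \<Longrightarrow> e < D \<Longrightarrow> approx_dis D y e \<le> (1 + \<epsilon> / sqrt (real e)) * r"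
    and "approx_dis D y D \<le> r"
  shows "ads_loop D \<epsilon> r y d = (Yes (approx_dis D y D), D)"
  using assms(1,2)
\<comment> \<open>The induction descends from \<open>D\<close>, because the loop at \<open>d\<close>
  calls itself at \<open>Suc d\<close>.\<close>
proof (induction d rule: inc_induct)
  case base
  show ?case
    using assms(3) by (simp add: ads_loop.simps[of D \<epsilon> r y D])
next
  case (step d)
  have "approx_dis D y d \<le> (1 + \<epsilon> / sqrt (real d)) * r"
    using step by simp
  moreover have "ads_loop D \<epsilon> r y (Suc d) = (Yes (approx_dis D y D), D)"
    using step by simp
  ultimately show ?case
    using step.hyps by (simp add: ads_loop.simps[of D \<epsilon> r y d])
qed

text \<open>Each move from \<open>d\<close> to \<open>Suc d\<close> is paid for by the summand of
  the step that did not reject. The sum may also count steps after the stop; in exchange its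
  expectation is a plain sum of probabilities, with no joint law involved.\<close>

lemma ads_loop_stop_le:
  assumes "d \<le> D"
  shows "real (snd (ads_loop D \<epsilon> r y d)) \<le> real d +
     (\<Sum>e=d..<D. if approx_dis D y e \<le> (1 + \<epsilon> / sqrt (real e)) * r then 1 else 0)"
  using assms
proof (induction d rule: inc_induct)
  case base
  show ?case
    by (simp add: ads_loop.simps[of D \<epsilon> r y D])
next
  case (step d)
  show ?case
  proof (cases "approx_dis D y d > (1 + \<epsilon> / sqrt (real d)) * r")
    case True
    then show ?thesis
      using step by (simp add: ads_loop.simps[of D \<epsilon> r y d] sum_nonneg)
  next
    case False
    then show ?thesis
      using step by (simp add: ads_loop.simps[of D \<epsilon> r y d] sum.atLeast_Suc_lessThan)
  qed
qed

section \<open>Two elementary estimates, uniform in \<open>D\<close>\<close>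

lemma geometric_sum_exp_le:
  fixes a :: real
  assumes "a > 0"
  shows "(\<Sum>d=1..<D. exp (- a) ^ d) \<le> 1 + 1 / a"
proof -
  have "(\<Sum>d=1..<D. exp (- a) ^ d) \<le> (\<Sum>d<D. exp (- a) ^ d)"
    by (intro sum_mono2) auto
  also have "\<dots> \<le> (\<Sum>d. exp (- a) ^ d)"
    using assms by (intro sum_le_suminf) (auto intro: summable_geometric)
  also have "\<dots> = 1 / (1 - exp (- a))"
    using assms by (subst suminf_geometric) auto
  also have "\<dots> \<le> 1 + 1 / a"
  proof -
    have "exp (- a) \<le> 1 / (1 + a)"
      using exp_ge_add_one_self[of a] assms by (simp add: exp_minus inverse_eq_divide frac_le)
    hence "1 - exp (- a) \<ge> a / (1 + a)"
      using assms by (simp add: field_simps)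
    hence "1 / (1 - exp (- a)) \<le> 1 / (a / (1 + a))"
      using assms by (intro divide_left_mono) auto
    thus ?thesis
      using assms by (simp add: field_simps)
  qed
  finally show ?thesis .
qed

text \<open>The count starts at 1, so it is bounded by the floor of \<open>T\<close> with no
  additional 1.\<close>

lemma card_nat_below_real_le:
  assumes "T \<ge> (0::real)"
  shows "real (card {d\<in>{1..<D}. real d < T}) \<le> T"
proof -
  have "card {d\<in>{1..<D}. real d < T} \<le> card {1..nat \<lfloor>T\<rfloor>}"
    by (intro card_mono) (auto simp: le_nat_floor)
  also have "real \<dots> \<le> T"
    using assms by simp
  finally show ?thesis by simp
qed

section \<open>Probability of failure\<close>

lemma ads_failure_probability:
  assumes c: "c > 0" "projection_concentration c" and D: "D \<ge> 1"
    and \<delta>: "0 < \<delta>" "\<delta> < 1" and \<epsilon>: "\<epsilon> > 0" "c * \<epsilon>\<^sup>2 \<ge> ln (real D / \<delta>)"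
    and M: "haar_orthogonal D M"
    and v: "ob \<in> carrier_vec D" "q \<in> carrier_vec D" and r: "r > 0" "vec_l2 (ob - q) \<le> r"
  shows "measure M {P \<in> space M. ads_fails D \<epsilon> ob q r P} \<le> \<delta>"
proof -
  interpret prob_space M
    using M by (simp add: haar_orthogonal_def)
  define x where "x = ob - q"
  have x: "x \<in> carrier_vec D"
    using v by (simp add: x_def)
  \<comment> \<open>The threshold uses \<open>vec_l2 x\<close> instead of \<open>r\<close> so that
    concentration applies directly; since \<open>vec_l2 x \<le> r\<close>, a rejection at step
    \<open>d\<close> still implies \<open>B d\<close>.\<close>
  define B where
    "B d = {P \<in> space M. approx_dis D (P *\<^sub>v x) d > (1 + \<epsilon> / sqrt (real d)) * vec_l2 x}" for d
  have B_sets: "B d \<in> sets M" if "d \<le> D" for d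
    using measurable_approx_dis_haar[OF M x that] unfolding B_def by measurable
  have B_prob: "measure M (B d) \<le> \<delta> / D" if "d \<in> {1..<D}" for d
  proof -
    have "measure M (B d) \<le> exp (- c * real d * (\<epsilon> / sqrt (real d))\<^sup>2)"
      unfolding B_def using that \<epsilon> by (intro approx_dis_concentration(1)[OF c(2) M x]) auto
    \<comment> \<open>Dividing by \<open>sqrt d\<close> cancels the factor \<open>d\<close>, so all
      steps share one bound.\<close>
    also have "- c * real d * (\<epsilon> / sqrt (real d))\<^sup>2 = - (c * \<epsilon>\<^sup>2)"
      using that by (simp add: power_divide)
    also have "exp \<dots> \<le> exp (- ln (real D / \<delta>))"
      using \<epsilon> by simp
    also have "\<dots> = \<delta> / D"
      using D \<delta> by (simp add: exp_minus)
    finally show ?thesis .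
  qed
  have "{P \<in> space M. ads_fails D \<epsilon> ob q r P} \<subseteq> (\<Union>d\<in>{1..<D}. B d)"
  proof safe
    fix P assume P: "P \<in> space M" and fails: "ads_fails D \<epsilon> ob q r P"
    have full: "approx_dis D (P *\<^sub>v x) D = vec_l2 x"
      using P space_haar_orthogonal[OF M] x D by (intro approx_dis_full) auto
    show "P \<in> (\<Union>d\<in>{1..<D}. B d)"
    \<comment> \<open>Outside all \<open>B d\<close> no step rejects, so the loop reaches
      \<open>D\<close> and by \<open>full\<close> reports the exact distance.\<close>
    proof (rule ccontr)
      assume "P \<notin> (\<Union>d\<in>{1..<D}. B d)"
      hence below: "approx_dis D (P *\<^sub>v x) d \<le> (1 + \<epsilon> / sqrt (real d)) * vec_l2 x"
        if "1 \<le> d" "d < D" for d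
        using that P by (force simp: B_def not_less)
      have "approx_dis D (P *\<^sub>v x) d \<le> (1 + \<epsilon> / sqrt (real d)) * r" if "1 \<le> d" "d < D" for d
      proof -
        have "(1 + \<epsilon> / sqrt (real d)) * vec_l2 x \<le> (1 + \<epsilon> / sqrt (real d)) * r"
          using r \<epsilon> by (intro mult_left_mono) (auto simp: x_def intro: add_nonneg_nonneg)
        with below[OF that] show ?thesis
          by (rule order_trans)
      qed
      hence "ads_loop D \<epsilon> r (P *\<^sub>v x) 1 = (Yes (vec_l2 x), D)"
        using ads_loop_no_rejection[of 1 D "P *\<^sub>v x" \<epsilon> r] D r full by (simp add: x_def)
      thus False
        using fails r by (simp add: ads_fails_def ad_sampling_def dco_def x_def)
    qed
  qed
  hence "measure M {P \<in> space M. ads_fails D \<epsilon> ob q r P} \<le> measure M (\<Union>d\<in>{1..<D}. B d)"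
    using B_sets by (intro finite_measure_mono) auto
  also have "\<dots> \<le> (\<Sum>d\<in>{1..<D}. measure M (B d))"
    using B_sets by (intro finite_measure_subadditive_finite) auto
  also have "\<dots> \<le> (\<Sum>d\<in>{1..<D}. \<delta> / D)"
    by (intro sum_mono B_prob)
  also have "\<dots> = real (D - 1) * (\<delta> / D)"
    by simp
  also have "\<dots> \<le> real D * (\<delta> / D)"
    using \<delta> by (intro mult_right_mono) auto
  also have "\<dots> = \<delta>"
    using D by simp
  finally show ?thesis .
qed

section \<open>Expected stopping time\<close>

lemma ads_expected_stop_le_sum:
  assumes M: "haar_orthogonal D M" and D: "D \<ge> 1"
    and v: "ob \<in> carrier_vec D" "q \<in> carrier_vec D"
  shows "(LINT P|M. real (ads_stop D \<epsilon> ob q r P)) \<le> 1 + (\<Sum>d=1..<D.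
     measure M {P \<in> space M.
       approx_dis D (P *\<^sub>v (ob - q)) d \<le> (1 + \<epsilon> / sqrt (real d)) * r})"
proof -
  interpret prob_space M
    using M by (simp add: haar_orthogonal_def)
  define E where "E d = {P \<in> space M.
       approx_dis D (P *\<^sub>v (ob - q)) d \<le> (1 + \<epsilon> / sqrt (real d)) * r}" for d
  have E_sets: "E d \<in> sets M" if "d \<in> {1..<D}" for d
  proof -
    have [measurable]: "(\<lambda>P. approx_dis D (P *\<^sub>v (ob - q)) d) \<in> borel_measurable M"
      using that v by (intro measurable_approx_dis_haar[OF M]) auto
    show ?thesis
      unfolding E_def by measurable
  qed
  have int: "integrable M (indicator (E d) :: _ \<Rightarrow> real)" if "d \<in> {1..<D}" for d
    using E_sets[OF that] by (simp add: integrable_real_indicator emeasure_eq_measure)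
  have "(LINT P|M. real (ads_stop D \<epsilon> ob q r P))
      \<le> (LINT P|M. 1 + (\<Sum>d=1..<D. indicator (E d) P))"
  \<comment> \<open>This rule asks for integrability and nonnegativity of the upper function only.
    The integral of a non-integrable function is 0 by default, so the stopping time itself is not
    shown measurable.\<close>
  proof (rule integral_mono')
    show "integrable M (\<lambda>P. 1 + (\<Sum>d=1..<D. indicator (E d) P :: real))"
      using int by (intro Bochner_Integration.integrable_add Bochner_Integration.integrable_sum) auto
  next
    fix P assume P: "P \<in> space M"
    have "real (ads_stop D \<epsilon> ob q r P) \<le> real 1 + (\<Sum>d=1..<D.
        if approx_dis D (P *\<^sub>v (ob - q)) d \<le> (1 + \<epsilon> / sqrt (real d)) * r then 1 else 0)"
      unfolding ads_stop_def ad_sampling_def by (rule ads_loop_stop_le[OF D])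
    also have "\<dots> = 1 + (\<Sum>d=1..<D. indicator (E d) P)"
      using P unfolding E_def indicator_def by (intro arg_cong2[of _ _ _ _ "(+)"] sum.cong) auto
    finally show "real (ads_stop D \<epsilon> ob q r P) \<le> 1 + (\<Sum>d=1..<D. indicator (E d) P)" .
  qed (auto intro!: add_nonneg_nonneg sum_nonneg)
  also have "\<dots> = 1 + (\<Sum>d=1..<D. measure M (E d))"
    using int E_sets by (subst Bochner_Integration.integral_add)
      (auto simp: Bochner_Integration.integral_sum prob_space sets.Int_space_eq2)
  finally show ?thesis
    by (simp add: E_def)
qed

text \<open>Supplies the \<open>D\<close> branch of the minimum, each of the \<open>D - 1\<close>
  probabilities being at most 1.\<close>

lemma ads_expected_stop_le_dim:
  assumes M: "haar_orthogonal D M" and D: "D \<ge> 1"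
    and v: "ob \<in> carrier_vec D" "q \<in> carrier_vec D"
  shows "(LINT P|M. real (ads_stop D \<epsilon> ob q r P)) \<le> real D"
proof -
  interpret prob_space M
    using M by (simp add: haar_orthogonal_def)
  have "(LINT P|M. real (ads_stop D \<epsilon> ob q r P)) \<le> 1 + (\<Sum>d=1..<D.
     measure M {P \<in> space M.
       approx_dis D (P *\<^sub>v (ob - q)) d \<le> (1 + \<epsilon> / sqrt (real d)) * r})"
    by (rule ads_expected_stop_le_sum[OF assms])
  also have "\<dots> \<le> 1 + (\<Sum>d=1..<D. 1)"
    by (intro add_left_mono sum_mono) simp
  also have "\<dots> = real D"
    using D by (simp add: of_nat_diff)
  finally show ?thesis .
qed

lemma ads_expected_stop_bound:
  assumes c: "c > 0" "projection_concentration c" and D: "D \<ge> 1" and \<epsilon>: "\<epsilon> > 0"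
    and M: "haar_orthogonal D M"
    and v: "ob \<in> carrier_vec D" "q \<in> carrier_vec D" and r: "r > 0"
    and \<alpha>: "\<alpha> > 0" "vec_l2 (ob - q) = (1 + \<alpha>) * r"
  shows "(LINT P|M. real (ads_stop D \<epsilon> ob q r P))
     \<le> 2 + 4 * \<epsilon>\<^sup>2 / \<alpha>\<^sup>2 + 32 / c * (1 + 1 / \<alpha>\<^sup>2)"
proof -
  interpret prob_space M
    using M by (simp add: haar_orthogonal_def)
  define x where "x = ob - q"
  have x: "x \<in> carrier_vec D"
    using v by (simp add: x_def)
  \<comment> \<open>From \<open>d = T\<close> on, the slack \<open>\<epsilon> / sqrt d\<close> is at
    most \<open>\<alpha> / 2\<close>.\<close>
  define T where "T = 4 * \<epsilon>\<^sup>2 / \<alpha>\<^sup>2"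
  \<comment> \<open>Chosen so that
    \<open>(1 - \<eta>) * (1 + \<alpha>) = 1 + 3 * \<alpha> / 4\<close>, strictly above the late
    thresholds, which are at most \<open>1 + \<alpha> / 2\<close> in units of
    \<open>r\<close>.\<close>
  define \<eta> where "\<eta> = \<alpha> / (4 * (1 + \<alpha>))"
  define a where "a = c * \<eta>\<^sup>2"
  have \<eta>: "\<eta> > 0" and a: "a > 0"
    using \<alpha> c by (auto simp: \<eta>_def a_def)
  define E where "E d = {P \<in> space M.
       approx_dis D (P *\<^sub>v x) d \<le> (1 + \<epsilon> / sqrt (real d)) * r}" for d
  \<comment> \<open>The exponential term is kept below \<open>T\<close> as well, so that the sum
    splits into a count and a geometric series over the same range.\<close>
  have E_prob: "measure M (E d) \<le> (if real d < T then 1 else 0) + exp (- a) ^ d"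
    if d: "d \<in> {1..<D}" for d
  proof (cases "real d < T")
    case True
    have "measure M (E d) \<le> 1" "exp (- a) ^ d \<ge> 0"
      by simp_all
    hence "measure M (E d) \<le> 1 + exp (- a) ^ d"
      by linarith
    with True show ?thesis by simp
  next
    case False
    have "(2 * \<epsilon> / \<alpha>)\<^sup>2 \<le> real d"
      using False by (simp add: T_def power_divide power_mult_distrib)
    hence "2 * \<epsilon> / \<alpha> \<le> sqrt (real d)"
      by (rule real_le_rsqrt)
    hence small: "\<epsilon> / sqrt (real d) \<le> \<alpha> / 2"
      using d \<alpha> by (simp add: field_simps)
    have "(1 - \<eta>) * vec_l2 x = (1 + 3 * \<alpha> / 4) * r"
      using \<alpha> unfolding x_def \<eta>_def by (simp add: field_simps)
    moreover have "(1 + \<epsilon> / sqrt (real d)) * r < (1 + 3 * \<alpha> / 4) * r"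
    proof (rule mult_strict_right_mono[OF _ r])
      show "1 + \<epsilon> / sqrt (real d) < 1 + 3 * \<alpha> / 4"
        using small \<alpha>(1) by linarith
    qed
    ultimately have sub:
      "E d \<subseteq> {P \<in> space M. approx_dis D (P *\<^sub>v x) d < (1 - \<eta>) * vec_l2 x}"
      unfolding E_def by auto
    have [measurable]: "(\<lambda>P. approx_dis D (P *\<^sub>v x) d) \<in> borel_measurable M"
      using d by (intro measurable_approx_dis_haar[OF M x]) auto
    have "measure M (E d) \<le> measure M {P \<in> space M. approx_dis D (P *\<^sub>v x) d < (1 - \<eta>) * vec_l2 x}"
      by (intro finite_measure_mono[OF sub]) measurable
    also have "\<dots> \<le> exp (- c * real d * \<eta>\<^sup>2)"
      using d \<eta> by (intro approx_dis_concentration(2)[OF c(2) M x]) auto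
    also have "\<dots> = exp (- a) ^ d"
      by (simp add: a_def flip: exp_of_nat_mult)
    finally show ?thesis
      using False by simp
  qed
  have "(LINT P|M. real (ads_stop D \<epsilon> ob q r P)) \<le> 1 + (\<Sum>d=1..<D. measure M (E d))"
    unfolding E_def x_def by (rule ads_expected_stop_le_sum[OF M D v])
  also have "\<dots> \<le> 1 + (\<Sum>d=1..<D. (if real d < T then 1 else 0) + exp (- a) ^ d)"
    by (intro add_left_mono sum_mono E_prob)
  also have "\<dots> = 1 + (real (card {d\<in>{1..<D}. real d < T}) + (\<Sum>d=1..<D. exp (- a) ^ d))"
    by (simp add: sum.distrib sum.If_cases Int_def conj_commute)
  also have "\<dots> \<le> 1 + (T + (1 + 1 / a))"
    using a by (intro add_left_mono add_mono geometric_sum_exp_le card_nat_below_real_le)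
      (auto simp: T_def)
  \<comment> \<open>Here \<open>1 / \<eta> = 4 * (1 + 1 / \<alpha>)\<close> gives the 16, and
    \<open>(1 + t)\<^sup>2 \<le> 2 * (1 + t\<^sup>2)\<close> doubles it.\<close>
  also have "1 / a \<le> 32 / c * (1 + 1 / \<alpha>\<^sup>2)"
  proof -
    have "1 / a = 16 / c * (1 + 1 / \<alpha>)\<^sup>2"
      using \<alpha> c by (simp add: a_def \<eta>_def field_simps power2_eq_square)
    also have "(1 + 1 / \<alpha>)\<^sup>2 \<le> 2 * (1 + 1 / \<alpha>\<^sup>2)"
      using zero_le_power2[of "1 - 1 / \<alpha>"] by (simp add: power2_eq_square algebra_simps)
    finally show ?thesis
      using c by (simp add: field_simps)
  qed
  finally show ?thesis
    by (simp add: T_def)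
qed

section \<open>Assembling both bounds with a constant depending only on
  \<open>c\<^sub>0\<close>\<close>

theorem theorem3p4:
  fixes c\<^sub>0 :: real
  assumes "c\<^sub>0 > 0"
    and "projection_concentration c\<^sub>0"
  shows "\<exists>C::real. C > 0 \<and>
    (\<forall>(D::nat) (\<delta>::real) (\<epsilon>\<^sub>0::real) (M::real mat measure).
       D \<ge> 1 \<longrightarrow> 0 < \<delta> \<longrightarrow> \<delta> < 1 \<longrightarrow>
       \<epsilon>\<^sub>0 = max 1 (sqrt (ln (real D / \<delta>) / c\<^sub>0)) \<longrightarrow>
       haar_orthogonal D M \<longrightarrow>
       (\<forall>ob \<in> carrier_vec D. \<forall>q \<in> carrier_vec D. \<forall>r > 0.
          vec_l2 (ob - q) \<le> r \<longrightarrow>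
          measure M {P' \<in> space M. ads_fails D \<epsilon>\<^sub>0 ob q r P'} \<le> \<delta>) \<and>
       (\<forall>ob \<in> carrier_vec D. \<forall>q \<in> carrier_vec D. \<forall>r > 0. \<forall>dis \<alpha>.
          dis = vec_l2 (ob - q) \<longrightarrow> dis > r \<longrightarrow> \<alpha> = (dis - r) / r \<longrightarrow>
          (LINT P'|M. real (ads_stop D \<epsilon>\<^sub>0 ob q r P'))
            \<le> C * min (real D) (max 1 (1 / \<alpha>\<^sup>2 * ln (real D / \<delta>)))))"
proof (intro exI[of _ "10 + 100 / c\<^sub>0"] conjI allI ballI impI)
  show "10 + 100 / c\<^sub>0 > 0"
    using assms(1) by (simp add: add_pos_pos)
next
  fix D :: nat and \<delta> \<epsilon>\<^sub>0 :: real and M :: "real mat measure" and ob q :: "real vec" and r :: real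
  assume D: "D \<ge> 1" and \<delta>: "0 < \<delta>" "\<delta> < 1"
    and \<epsilon>\<^sub>0: "\<epsilon>\<^sub>0 = max 1 (sqrt (ln (real D / \<delta>) / c\<^sub>0))"
    and M: "haar_orthogonal D M"
    and v: "ob \<in> carrier_vec D" "q \<in> carrier_vec D" and r: "r > 0"
  define L where "L = ln (real D / \<delta>)"
  have L: "L \<ge> 0"
    using D \<delta> by (simp add: L_def)
  have \<epsilon>\<^sub>0_pos: "\<epsilon>\<^sub>0 > 0"
    using \<epsilon>\<^sub>0 by simp
  have sqrt_sq: "(sqrt (L / c\<^sub>0))\<^sup>2 = L / c\<^sub>0"
    using L assms(1) by simp
  {
    assume "vec_l2 (ob - q) \<le> r"
    moreover have "c\<^sub>0 * \<epsilon>\<^sub>0\<^sup>2 \<ge> ln (real D / \<delta>)"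
    proof -
      have "(sqrt (L / c\<^sub>0))\<^sup>2 \<le> \<epsilon>\<^sub>0\<^sup>2"
        using L assms(1) by (intro power_mono) (auto simp: \<epsilon>\<^sub>0 L_def)
      thus ?thesis
        using assms(1) unfolding sqrt_sq by (simp add: pos_divide_le_eq L_def mult.commute)
    qed
    ultimately show "measure M {P' \<in> space M. ads_fails D \<epsilon>\<^sub>0 ob q r P'} \<le> \<delta>"
      using ads_failure_probability[OF assms D \<delta> \<epsilon>\<^sub>0_pos _ M v r] by simp
  }
  {
    fix dis \<alpha> :: real
    assume dis: "dis = vec_l2 (ob - q)" "dis > r" and \<alpha>: "\<alpha> = (dis - r) / r"
    define m where "m = max 1 (1 / \<alpha>\<^sup>2 * L)"
    have \<alpha>_pos: "\<alpha> > 0"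
      using dis \<alpha> r by simp
    have dis_eq: "vec_l2 (ob - q) = (1 + \<alpha>) * r"
      using dis \<alpha> r by (simp add: field_simps)
    have le_dim: "(LINT P'|M. real (ads_stop D \<epsilon>\<^sub>0 ob q r P')) \<le> real D"
      by (rule ads_expected_stop_le_dim[OF M D v])
    have C1: "1 \<le> 10 + 100 / c\<^sub>0"
      using assms(1) by (simp add: add_increasing2)
    have le_m: "(LINT P'|M. real (ads_stop D \<epsilon>\<^sub>0 ob q r P')) \<le> (10 + 100 / c\<^sub>0) * m"
    proof (cases "D = 1")
      case True
      have "1 * 1 \<le> (10 + 100 / c\<^sub>0) * m"
        using C1 by (intro mult_mono) (auto simp: m_def)
      with True le_dim show ?thesis by simp
    next
      case False
      \<comment> \<open>A lower bound on \<open>L\<close> lets the bare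
        \<open>1 / \<alpha>\<^sup>2\<close> be absorbed into \<open>L / \<alpha>\<^sup>2\<close> at
        the cost of a factor 2.\<close>
      have "1 / 2 \<le> ln (2::real)"
        using ln_le_minus_one[of "1 / 2 :: real"] by (simp add: ln_div)
      also have "ln 2 \<le> L"
      proof -
        have "2 \<le> real D"
          using D False by simp
        also have "\<dots> \<le> real D / \<delta>"
          using \<delta> by (simp add: pos_le_divide_eq mult_left_le)
        finally show ?thesis
          unfolding L_def by simp
      qed
      finally have L_half: "1 \<le> 2 * L" by simp
      have m1: "m \<ge> 1" and mL: "L / \<alpha>\<^sup>2 \<le> m"
        by (auto simp: m_def)
      have "1 / \<alpha>\<^sup>2 \<le> 2 * L / \<alpha>\<^sup>2"
        using L_half by (intro divide_right_mono) auto
      with mL have inv: "1 / \<alpha>\<^sup>2 \<le> 2 * m" by simp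
      \<comment> \<open>The square of a maximum of nonnegative numbers is at most the sum of their
        squares.\<close>
      have "\<epsilon>\<^sub>0\<^sup>2 \<le> 1 + L / c\<^sub>0"
        using sqrt_sq L assms(1) unfolding \<epsilon>\<^sub>0 L_def[symmetric] by (auto simp: max_def)
      hence "\<epsilon>\<^sub>0\<^sup>2 / \<alpha>\<^sup>2 \<le> (1 + L / c\<^sub>0) / \<alpha>\<^sup>2"
        by (intro divide_right_mono) auto
      also have "\<dots> = 1 / \<alpha>\<^sup>2 + (L / \<alpha>\<^sup>2) / c\<^sub>0"
        by (simp add: add_divide_distrib)
      also have "\<dots> \<le> 2 * m + m / c\<^sub>0"
        using inv mL assms(1) by (intro add_mono divide_right_mono) auto
      finally have eps: "\<epsilon>\<^sub>0\<^sup>2 / \<alpha>\<^sup>2 \<le> 2 * m + m / c\<^sub>0" .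
      have "(LINT P'|M. real (ads_stop D \<epsilon>\<^sub>0 ob q r P'))
          \<le> 2 + 4 * (\<epsilon>\<^sub>0\<^sup>2 / \<alpha>\<^sup>2) + 32 / c\<^sub>0 * (1 + 1 / \<alpha>\<^sup>2)"
        using ads_expected_stop_bound[OF assms D \<epsilon>\<^sub>0_pos M v r \<alpha>_pos dis_eq] by simp
      \<comment> \<open>The witness is read off here: \<open>2 + 8 = 10\<close>, and over
        \<open>c\<^sub>0\<close> the terms \<open>4 + 32 * 3 = 100\<close>.\<close>
      also have "\<dots> \<le> 2 * m + 4 * (2 * m + m / c\<^sub>0) + 32 / c\<^sub>0 * (m + 2 * m)"
        using m1 eps inv assms(1) by (intro add_mono mult_left_mono) auto
      also have "\<dots> = (10 + 100 / c\<^sub>0) * m"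
        using assms(1) by (simp add: field_simps)
      finally show ?thesis .
    qed
    \<comment> \<open>A constant of at least 1 makes the bound by \<open>D\<close> fit the other
      branch of the minimum.\<close>
    have "real D \<le> (10 + 100 / c\<^sub>0) * real D"
      using mult_right_mono[OF C1, of "real D"] by simp
    with le_dim le_m show "(LINT P'|M. real (ads_stop D \<epsilon>\<^sub>0 ob q r P'))
        \<le> (10 + 100 / c\<^sub>0) * min (real D) (max 1 (1 / \<alpha>\<^sup>2 * ln (real D / \<delta>)))"
      unfolding m_def L_def by (simp add: min_def)
  }
qed

end
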